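(* Let $n>1$ be an integer with $\gcd(n,6)=1$, and let $e\in\{2,3,4,6\}$. Then $$\sum_{\substack{r=1\\ \gcd(r,n)=1}}^{\lfloor n/e\rfloor}\frac{1}{r^{2}}\equiv -J_{e}(n)\,n^{\phi(n)-2}\,\phi_{J_{e}}^{(2-\phi(n))}(n)\,\frac{B_{\phi(n)-1}\!\left(\frac{1}{e}\right)}{\phi(n)-1}\pmod{n}.$$
   Context: $\phi$ is Euler's totient function and $\mu$ the Möbius function. For an integer $k$ (possibly negative) and an arithmetic function $f$, define $\phi^{(k)}_{f}(n):=\sum_{d\mid n}\left(\frac{n}{d}\right)^{k}f(d)\mu(d)$ (a rational number). For $e\in\{2,3,4,6\}$ and an integer $m$ coprime to $6$, $J_e(m)=1$ if $m\equiv 1\pmod e$ and $J_e(m)=-1$ if $m\equiv -1\pmod e$ (so $J_2(m)=1$ for odd $m$); $J_e$ is applied to divisors of $n$ in $\phi^{(k)}_{J_e}$. $B_m(x)$ denotes the $m$-th Bernoulli polynomial, defined by $\frac{te^{xt}}{e^t-1}=\sum_{m\ge0}B_m(x)\frac{t^m}{m!}$. Congruences between rational numbers modulo a positive integer $M$ mean that the difference equals $M$ times a rational number whose denominator is coprime to $M$. *)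

theory Defs
  imports "HOL-Number_Theory.Number_Theory" "HOL-Computational_Algebra.Squarefree"
    "HOL-Computational_Algebra.Formal_Power_Series"
begin

definition moebius_mu :: "nat \<Rightarrow> int" where
  "moebius_mu n = (if squarefree n then (- 1) ^ card (prime_factors n) else 0)"

definition gen_totient :: "int \<Rightarrow> (nat \<Rightarrow> int) \<Rightarrow> nat \<Rightarrow> rat" where
  "gen_totient k f n =
     (\<Sum>d | d dvd n. (of_nat n / of_nat d) powi k * of_int (f d) * of_int (moebius_mu d))"

(* Only used for e in {2, 3, 4, 6} and m coprime to 6, where the value 0 does not occur.
   For e = 2 both congruences hold, and the value is 1. *)
definition J :: "nat \<Rightarrow> int \<Rightarrow> int" where
  "J e m = (if [m = 1] (mod int e) then 1 else if [m = - 1] (mod int e) then - 1 else 0)"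

(* The quotient is taken in the power series ring over rat: fps_exp 1 - 1 has subdegree 1 and
   divides fps_X * fps_exp x exactly (see bernoulli_poly_generating). *)
definition bernoulli_poly :: "nat \<Rightarrow> rat \<Rightarrow> rat" where
  "bernoulli_poly m x = fact m * fps_nth (fps_X * fps_exp x / (fps_exp 1 - 1)) m"

lemma bernoulli_poly_generating:
  "Abs_fps (\<lambda>m. bernoulli_poly m x / fact m) * (fps_exp 1 - 1) = fps_X * fps_exp x"
proof -
  let ?g = "fps_exp 1 - 1 :: rat fps"
  have g: "fps_nth ?g 0 = 0" "fps_nth ?g 1 = 1" by simp_all
  then have nz: "?g \<noteq> 0" by auto
  have "subdegree ?g = 1" by (rule subdegreeI) (use g in auto)
  then have "?g dvd fps_X * fps_exp x"
    using nz by (subst fps_dvd_iff) auto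
  moreover have "Abs_fps (\<lambda>m. bernoulli_poly m x / fact m) = fps_X * fps_exp x / ?g"
    by (rule fps_ext) (simp add: bernoulli_poly_def)
  ultimately show ?thesis by simp
qed

definition rat_cong :: "rat \<Rightarrow> rat \<Rightarrow> nat \<Rightarrow> bool" where
  "rat_cong a b M \<longleftrightarrow> (\<exists>q. a - b = of_nat M * q \<and> coprime (snd (quotient_of q)) (int M))"

end

theory Submission
  imports Defs
begin

text \<open>
  Put \<open>k = totient n - 2\<close> and \<open>P x = bernoulli_poly (k + 1) x / (k + 1)\<close>, so that
  \<open>P (x + 1) - P x = x ^ k\<close>. Modulo \<open>n\<close> one may replace \<open>1 / r\<^sup>2\<close> by \<open>r ^ k\<close>, and Moebius
  inversion reduces the claim to evaluating \<open>P (N div e + 1)\<close> modulo \<open>N\<close> for each \<open>N dvd n\<close>.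
  Here \<open>N div e + 1 = a + N / e\<close> with \<open>a\<close> equal to \<open>1 / e\<close> or \<open>1 - 1 / e\<close>, and the point is that
  \<open>P (a + N / e) \<equiv> P a\<close> modulo \<open>N\<close>. No information on denominators of Bernoulli numbers is needed:
  being a polynomial, \<open>P\<close> is continuous for the \<open>n\<close>-adic topology, so \<open>a\<close> may be replaced by an
  integer congruent to it modulo a high power of \<open>n\<close>. The difference is then a sum of \<open>k\<close>-th powers
  over complete residue systems modulo \<open>N\<close>. Such a sum \<open>T\<close> satisfies \<open>2 ^ k * T \<equiv> T\<close>, where
  \<open>4 * 2 ^ k \<equiv> 1\<close>; hence \<open>3 * T \<equiv> 0\<close>, and \<open>T \<equiv> 0\<close> as \<open>N\<close> is coprime to 6.
\<close>

section \<open>Bernoulli polynomials\<close>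

lemma fps_exp_minus_one_nonzero: "fps_exp 1 - 1 \<noteq> (0 :: rat fps)"
proof
  assume "fps_exp 1 - 1 = (0 :: rat fps)"
  then have "fps_nth (fps_exp 1 - 1 :: rat fps) 1 = 0" by simp
  then show False by simp
qed

text \<open>Passing from \<open>x\<close> to \<open>x + 1\<close> multiplies the right side of the
  generating identity by \<open>fps_exp 1\<close>. The difference therefore contains the factor
  \<open>fps_exp 1 - 1\<close>, which cancels, and coefficients can be compared.\<close>

lemma bernoulli_poly_add_one:
  "bernoulli_poly (Suc k) (x + 1) - bernoulli_poly (Suc k) x = of_nat (Suc k) * x ^ k"
proof -
  let ?H = "\<lambda>x. Abs_fps (\<lambda>m. bernoulli_poly m x / fact m)"
  let ?g = "fps_exp 1 - 1 :: rat fps"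
  have "(?H (x + 1) - ?H x) * ?g = fps_X * fps_exp (x + 1) - fps_X * fps_exp x"
    by (simp add: left_diff_distrib bernoulli_poly_generating)
  also have "\<dots> = (fps_X * fps_exp x) * ?g"
    by (simp add: fps_exp_add_mult algebra_simps)
  finally have "?H (x + 1) - ?H x = fps_X * fps_exp x"
    using fps_exp_minus_one_nonzero by simp
  then have "fps_nth (?H (x + 1) - ?H x) (Suc k) = fps_nth (fps_X * fps_exp x) (Suc k)"
    by (rule arg_cong)
  then have "(bernoulli_poly (Suc k) (x + 1) - bernoulli_poly (Suc k) x) / fact (Suc k) = x ^ k / fact k"
    by (simp add: diff_divide_distrib del: fact_Suc)
  then have "bernoulli_poly (Suc k) (x + 1) - bernoulli_poly (Suc k) x = fact (Suc k) * (x ^ k / fact k)"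
    by (simp only: divide_eq_eq fact_nonzero simp_thms if_True mult.commute)
  then show ?thesis by simp
qed

text \<open>Substitute \<open>- fps_X\<close> in the generating identity and multiply by
  \<open>fps_exp 1\<close>. This turns \<open>fps_exp (- 1) - 1\<close> into
  \<open>- (fps_exp 1 - 1)\<close> and \<open>fps_exp (- x)\<close> into
  \<open>fps_exp (1 - x)\<close>, which is the identity at \<open>1 - x\<close>.\<close>

lemma bernoulli_poly_reflect: "bernoulli_poly m (1 - x) = (- 1) ^ m * bernoulli_poly m x"
proof -
  let ?H = "\<lambda>x. Abs_fps (\<lambda>m. bernoulli_poly m x / fact m)"
  let ?g = "fps_exp 1 - 1 :: rat fps"
  have "(?H x oo - fps_X) * (?g oo - fps_X) = (fps_X * fps_exp x) oo - fps_X"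
    by (subst fps_compose_mult_distrib [symmetric]) (simp_all add: bernoulli_poly_generating)
  also have "(fps_X * fps_exp x) oo - fps_X = - fps_X * fps_exp (- x)"
    by (subst fps_compose_mult_distrib) simp_all
  also have "?g oo - fps_X = fps_exp (- 1) - 1"
    by (simp add: fps_compose_sub_distrib)
  finally have "(?H x oo - fps_X) * ((fps_exp (- 1) - 1) * fps_exp 1) =
      - fps_X * (fps_exp (- x) * fps_exp 1)"
    by (simp only: mult.assoc [symmetric])
  moreover have "fps_exp (- 1) * fps_exp 1 = (1 :: rat fps)"
    by (simp flip: fps_exp_add_mult)
  then have "(fps_exp (- 1) - 1) * fps_exp 1 = - ?g"
    by (simp add: left_diff_distrib)
  moreover have "fps_exp (- x) * fps_exp 1 = fps_exp (1 - x)"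
    by (simp flip: fps_exp_add_mult)
  ultimately have "- ((?H x oo - fps_X) * ?g) = - (?H (1 - x) * ?g)"
    by (simp only: bernoulli_poly_generating mult_minus_left mult_minus_right)
  then have "?H x oo - fps_X = ?H (1 - x)"
    using fps_exp_minus_one_nonzero by simp
  then have "fps_nth (?H x oo - fps_X) m = fps_nth (?H (1 - x)) m"
    by (rule arg_cong)
  then show ?thesis
    by (simp add: fps_compose_uminus')
qed

text \<open>The series at \<open>x\<close> is \<open>fps_exp x\<close> times the series at 0. Only
  the existence of rational coefficients is exported, as this is all that continuity
  requires.\<close>

lemma bernoulli_poly_polynomial:
  obtains c where "\<And>x. bernoulli_poly m x = (\<Sum>i\<le>m. c i * x ^ i)"
proof -
  let ?g = "fps_exp 1 - 1 :: rat fps"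
  let ?H = "\<lambda>x. Abs_fps (\<lambda>m. bernoulli_poly m x / fact m)"
  have "bernoulli_poly m x =
      (\<Sum>i\<le>m. (fact m / fact i * (bernoulli_poly (m - i) 0 / fact (m - i))) * x ^ i)" for x
  proof -
    have "?H x * ?g = fps_X * fps_exp x" "?H 0 * ?g = fps_X * fps_exp 0"
      by (rule bernoulli_poly_generating)+
    then have "?H x * ?g = (fps_exp x * ?H 0) * ?g"
      by (simp add: mult.assoc)
    then have "?H x = fps_exp x * ?H 0"
      using fps_exp_minus_one_nonzero mult_right_cancel by blast
    then have "bernoulli_poly m x / fact m = fps_nth (fps_exp x * ?H 0) m"
      by (metis fps_nth_Abs_fps)
    then have "bernoulli_poly m x = fact m * fps_nth (fps_exp x * ?H 0) m"
      by (simp add: field_simps)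
    then show ?thesis
      by (simp add: fps_mult_nth sum_distrib_left atLeast0AtMost mult_ac)
  qed
  then show ?thesis by (rule that)
qed

section \<open>The ring of rationals with denominator coprime to n\<close>

text \<open>The localization of the integers at the elements prime to \<open>n\<close>. The fraction
  need not be in lowest terms, so closure under the ring operations follows by multiplying
  denominators.\<close>

definition local_ints :: "nat \<Rightarrow> rat set" where
  "local_ints n = {q. \<exists>a b. q = of_int a / of_int b \<and> b \<noteq> 0 \<and> coprime b (int n)}"

lemma local_intsI: "coprime b (int n) \<Longrightarrow> b \<noteq> 0 \<Longrightarrow> of_int a / of_int b \<in> local_ints n"
  unfolding local_ints_def by blast

lemma of_int_in_local_ints [simp]: "of_int a \<in> local_ints n"
  using local_intsI [of 1 n a] by simp

lemma of_nat_in_local_ints [simp]: "of_nat a \<in> local_ints n"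
  using of_int_in_local_ints [of "int a" n] by simp

lemma zero_in_local_ints [simp]: "0 \<in> local_ints n"
  and one_in_local_ints [simp]: "1 \<in> local_ints n"
  using of_nat_in_local_ints [of 0 n] of_nat_in_local_ints [of 1 n] by simp_all

lemma local_ints_add [intro]:
  assumes "x \<in> local_ints n" "y \<in> local_ints n"
  shows "x + y \<in> local_ints n"
proof -
  obtain a b c d where "x = of_int a / of_int b" "b \<noteq> 0" "coprime b (int n)"
    "y = of_int c / of_int d" "d \<noteq> 0" "coprime d (int n)"
    using assms unfolding local_ints_def by blast
  then have "x + y = of_int (a * d + c * b) / of_int (b * d)" "b * d \<noteq> 0" "coprime (b * d) (int n)"
    by (auto simp: field_simps)
  then show ?thesis using local_intsI by metis
qed

lemma local_ints_mult [intro]: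
  assumes "x \<in> local_ints n" "y \<in> local_ints n"
  shows "x * y \<in> local_ints n"
proof -
  obtain a b c d where "x = of_int a / of_int b" "b \<noteq> 0" "coprime b (int n)"
    "y = of_int c / of_int d" "d \<noteq> 0" "coprime d (int n)"
    using assms unfolding local_ints_def by blast
  then have "x * y = of_int (a * c) / of_int (b * d)" "b * d \<noteq> 0" "coprime (b * d) (int n)"
    by auto
  then show ?thesis using local_intsI by metis
qed

lemma local_ints_diff [intro]:
  assumes "x \<in> local_ints n" "y \<in> local_ints n"
  shows "x - y \<in> local_ints n"
  using local_ints_add [OF assms(1) local_ints_mult [OF of_int_in_local_ints [of "- 1"] assms(2)]]
  by simp

lemma local_ints_power [intro]: "x \<in> local_ints n \<Longrightarrow> x ^ i \<in> local_ints n"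
  by (induction i) auto

lemma local_ints_sum [intro]:
  "(\<And>i. i \<in> A \<Longrightarrow> f i \<in> local_ints n) \<Longrightarrow> sum f A \<in> local_ints n"
  by (induction A rule: infinite_finite_induct) auto

lemma local_ints_inverse_of_nat:
  "coprime b n \<Longrightarrow> b > 0 \<Longrightarrow> 1 / of_nat b \<in> local_ints n"
  using local_intsI [of "int b" n 1] by simp

text \<open>The reduced denominator divides every other denominator of the same rational, so it
  inherits coprimality to \<open>n\<close>.\<close>

lemma rat_congI:
  assumes "a - b = of_nat n * q" "q \<in> local_ints n"
  shows "rat_cong a b n"
proof -
  obtain u v where uv: "q = of_int u / of_int v" "v \<noteq> 0" "coprime v (int n)"
    using assms(2) unfolding local_ints_def by blast
  obtain c d where cd: "quotient_of q = (c, d)" by (cases "quotient_of q")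
  then have "q = of_int c / of_int d" "d > 0" "coprime c d"
    using quotient_of_div quotient_of_denom_pos quotient_of_coprime by blast+
  then have "of_int (u * d) = (of_int (c * v) :: rat)"
    using uv by (simp add: field_simps)
  then have "u * d = c * v" by (simp only: of_int_eq_iff)
  then have "d dvd v"
    using \<open>coprime c d\<close> by (metis coprime_commute coprime_dvd_mult_right_iff dvd_triv_right)
  then have "coprime d (int n)"
    using uv(3) coprime_divisors [of d v "int n" "int n"] by simp
  then show ?thesis unfolding rat_cong_def using assms(1) cd by auto
qed

section \<open>Polynomials are continuous for the n-adic topology\<close>

text \<open>Strong induction on the denominator \<open>v\<close>: as long as \<open>v\<close> is not
  coprime to \<open>n\<close>, one factor \<open>n\<close> cancels \<open>gcd v n > 1\<close> and
  leaves a smaller denominator.\<close>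

lemma power_mult_in_local_ints:
  assumes "n > 0"
  shows "\<exists>L. of_nat n ^ L * q \<in> local_ints n"
proof -
  have "\<exists>L. of_nat n ^ L * (of_int u / of_nat v) \<in> local_ints n" if "v > 0" for u and v :: nat
    using that
  proof (induction v rule: less_induct)
    case (less v)
    show ?case
    proof (cases "coprime v n")
      case True
      then have "of_int u / of_int (int v) \<in> local_ints n"
        using less.prems by (intro local_intsI) auto
      then show ?thesis by (intro exI [of _ 0]) simp
    next
      case False
      define g where "g = gcd v n"
      have "g dvd v" "g dvd n" by (simp_all add: g_def)
      then obtain w h where w: "v = g * w" and h: "n = g * h" by (elim dvdE)
      have "g \<noteq> 1" using False unfolding g_def by (simp only: coprime_iff_gcd_eq_1 simp_thms)
      moreover have "g > 0" "w > 0" using w less.prems by (auto intro: Nat.gr0I)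
      ultimately have "w < v" using w by simp
      then obtain L where "of_nat n ^ L * (of_int u / of_nat w) \<in> local_ints n"
        using less.IH \<open>w > 0\<close> by blast
      then have "of_nat h * (of_nat n ^ L * (of_int u / of_nat w)) \<in> local_ints n"
        by (rule local_ints_mult [OF of_nat_in_local_ints])
      also have "of_nat h * (of_nat n ^ L * (of_int u / of_nat w)) =
          of_nat n ^ Suc L * (of_int u / of_nat v :: rat)"
        using \<open>w > 0\<close> \<open>g > 0\<close> unfolding power_Suc by (subst (2) h) (simp add: w field_simps)
      finally show ?thesis by blast
    qed
  qed
  moreover obtain c d where "quotient_of q = (c, d)" by (cases "quotient_of q")
  then have "q = of_int c / of_nat (nat d)" "nat d > 0"
    using quotient_of_div quotient_of_denom_pos by fastforce+
  ultimately show ?thesis by metis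
qed

text \<open>The power \<open>n ^ L\<close> clears the coefficients of their denominators, and
  \<open>x - y\<close> divides each \<open>x ^ i - y ^ i\<close> within the local ring. The exponent
  \<open>L\<close> does not depend on \<open>x\<close> and \<open>y\<close>, so these may be chosen
  after it.\<close>

lemma polynomial_lipschitz_local_ints:
  fixes c :: "nat \<Rightarrow> rat"
  assumes "n > 0"
  shows "\<exists>L. \<forall>x\<in>local_ints n. \<forall>y\<in>local_ints n. \<exists>q\<in>local_ints n.
    of_nat n ^ L * ((\<Sum>i<m. c i * x ^ i) - (\<Sum>i<m. c i * y ^ i)) = (x - y) * q"
proof (induction m)
  case 0
  show ?case by (auto intro!: bexI [of _ 0])
next
  case (Suc m)
  then obtain L where L: "\<And>x y. x \<in> local_ints n \<Longrightarrow> y \<in> local_ints n \<Longrightarrow> \<exists>q\<in>local_ints n.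
    of_nat n ^ L * ((\<Sum>i<m. c i * x ^ i) - (\<Sum>i<m. c i * y ^ i)) = (x - y) * q"
    by blast
  obtain K where K: "of_nat n ^ K * c m \<in> local_ints n"
    using power_mult_in_local_ints assms by blast
  show ?case
  proof (intro exI [of _ "L + K"] ballI)
    fix x y assume xy: "x \<in> local_ints n" "y \<in> local_ints n"
    obtain q where q: "q \<in> local_ints n"
      "of_nat n ^ L * ((\<Sum>i<m. c i * x ^ i) - (\<Sum>i<m. c i * y ^ i)) = (x - y) * q"
      using L xy by blast
    define r where "r = (\<Sum>i<m. y ^ (m - Suc i) * x ^ i)"
    have r: "r \<in> local_ints n" "x ^ m - y ^ m = (x - y) * r"
      using xy power_diff_sumr2 [of x m y] unfolding r_def by auto
    have "of_nat n ^ (L + K) * ((\<Sum>i<Suc m. c i * x ^ i) - (\<Sum>i<Suc m. c i * y ^ i)) =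
      of_nat n ^ K * (of_nat n ^ L * ((\<Sum>i<m. c i * x ^ i) - (\<Sum>i<m. c i * y ^ i))) +
      of_nat n ^ L * (of_nat n ^ K * c m) * (x ^ m - y ^ m)"
      by (simp add: power_add algebra_simps)
    also have "\<dots> = (x - y) * (of_nat n ^ K * q + of_nat n ^ L * (of_nat n ^ K * c m) * r)"
      by (simp only: q(2) r(2)) (simp add: algebra_simps)
    finally have "of_nat n ^ (L + K) * ((\<Sum>i<Suc m. c i * x ^ i) - (\<Sum>i<Suc m. c i * y ^ i)) =
      (x - y) * (of_nat n ^ K * q + of_nat n ^ L * (of_nat n ^ K * c m) * r)" .
    moreover have "of_nat n ^ K * q + of_nat n ^ L * (of_nat n ^ K * c m) * r \<in> local_ints n"
      by (intro local_ints_add) (rule local_ints_mult local_ints_power of_nat_in_local_ints q(1) r(1) K)+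
    ultimately show "\<exists>q\<in>local_ints n.
      of_nat n ^ (L + K) * ((\<Sum>i<Suc m. c i * x ^ i) - (\<Sum>i<Suc m. c i * y ^ i)) = (x - y) * q"
      by blast
  qed
qed

section \<open>Power sums over complete residue systems\<close>

text \<open>Doubling permutes the residues modulo the odd number \<open>N\<close>, so
  \<open>2 ^ k * T\<close> is congruent to \<open>T\<close>. By assumption \<open>2 ^ k\<close> is
  an inverse of 4, hence \<open>4 * T\<close> is congruent to \<open>T\<close>, and 3 is
  invertible.\<close>

lemma dvd_sum_power_lessThan:
  fixes N :: nat
  assumes "coprime N 6" and k: "[4 * 2 ^ k = 1] (mod N)"
  shows "N dvd (\<Sum>s<N. s ^ k)"
proof (cases "N = 0")
  case False
  let ?T = "\<Sum>s<N. s ^ k"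
  have cop: "coprime N 2" "coprime N 3"
    by (rule coprime_divisors [OF dvd_refl _ assms(1)], simp)+
  have inj: "inj_on (\<lambda>s. 2 * s mod N) {..<N}"
  proof (rule inj_onI)
    fix s t assume "s \<in> {..<N}" "t \<in> {..<N}" "2 * s mod N = 2 * t mod N"
    then have "[2 * s = 2 * t] (mod N)" "s < N" "t < N" by (auto simp: cong_def)
    then have "[s = t] (mod N)"
      using cop(1) cong_mult_lcancel_nat coprime_commute by blast
    then show "s = t" using \<open>s < N\<close> \<open>t < N\<close> by (simp add: cong_def)
  qed
  have "(\<lambda>s. 2 * s mod N) ` {..<N} = {..<N}"
    using False by (intro endo_inj_surj inj) auto
  then have "?T = (\<Sum>s<N. (2 * s mod N) ^ k)"
    using sum.reindex [OF inj, of "\<lambda>s. s ^ k"] by (simp add: o_def)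
  also have "[\<dots> = (\<Sum>s<N. (2 * s) ^ k)] (mod N)"
    by (intro cong_sum cong_pow) (simp add: cong_def)
  also have "(\<Sum>s<N. (2 * s) ^ k) = 2 ^ k * ?T"
    by (simp add: power_mult_distrib sum_distrib_left)
  finally have "[4 * ?T = (4 * 2 ^ k) * ?T] (mod N)"
    by (metis cong_scalar_left mult.assoc)
  also have "[(4 * 2 ^ k) * ?T = 1 * ?T] (mod N)"
    using k by (rule cong_scalar_right)
  finally have "[3 * ?T + ?T = 0 + ?T] (mod N)" by simp
  then have "N dvd 3 * ?T" by (simp only: cong_add_rcancel_nat cong_0_iff)
  then show ?thesis using cop(2) by (simp add: coprime_dvd_mult_right_iff)
qed auto

text \<open>Moving a window of length \<open>N\<close> by one place exchanges \<open>y ^ k\<close>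
  for the congruent \<open>(y + N) ^ k\<close>, so every window behaves like the first;
  \<open>t\<close> of them are then concatenated.\<close>

lemma dvd_sum_power_block:
  fixes N :: nat
  assumes "N dvd (\<Sum>s<N. s ^ k)"
  shows "N dvd (\<Sum>s = x..<x + N * t. s ^ k)"
proof -
  have block: "N dvd (\<Sum>s = y..<y + N. s ^ k)" for y
  proof (induction y)
    case 0
    then show ?case using assms by (simp add: atLeast0LessThan)
  next
    case (Suc y)
    have "(\<Sum>s = y..<y + N. s ^ k) + (y + N) ^ k = y ^ k + (\<Sum>s = Suc y..<Suc y + N. s ^ k)"
      by (metis add_Suc le_add1 sum.atLeastLessThan_Suc sum.atLeast_Suc_lessThan less_Suc_eq_le)
    moreover have "[(\<Sum>s = y..<y + N. s ^ k) + (y + N) ^ k = 0 + y ^ k] (mod N)"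
      using Suc by (intro cong_add cong_pow) (auto simp: cong_0_iff cong_def)
    ultimately have "[(\<Sum>s = Suc y..<Suc y + N. s ^ k) + y ^ k = 0 + y ^ k] (mod N)"
      by (simp add: add.commute)
    then show ?case by (simp only: cong_add_rcancel_nat cong_0_iff)
  qed
  show ?thesis
  proof (induction t)
    case (Suc t)
    have "(\<Sum>s = x..<x + N * Suc t. s ^ k) =
        (\<Sum>s = x..<x + N * t. s ^ k) + (\<Sum>s = x + N * t..<x + N * t + N. s ^ k)"
      by (subst sum.atLeastLessThan_concat) (auto simp: algebra_simps)
    then show ?case using Suc block by simp
  qed auto
qed

section \<open>Partial power sums and Bernoulli polynomials at rational points\<close>

lemma sum_power_bernoulli:
  assumes "x \<le> y"
  shows "of_nat (\<Sum>s = x..<y. s ^ k) =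
    (bernoulli_poly (Suc k) (of_nat y) - bernoulli_poly (Suc k) (of_nat x)) / of_nat (Suc k)"
  using assms
proof (induction rule: dec_induct)
  case (step y)
  have "bernoulli_poly (Suc k) (of_nat (Suc y)) =
      bernoulli_poly (Suc k) (of_nat y) + of_nat (Suc k) * of_nat y ^ k"
    using bernoulli_poly_add_one [of k "of_nat y"] by (simp add: add.commute)
  then show ?case
    using step by (simp add: field_simps del: of_nat_Suc)
qed simp

text \<open>The difference equation at 0 makes the values at 0 and 1 equal, and reflection in odd
  degree makes them opposite. Thus a power sum starting at 1 has no boundary term at its lower
  end.\<close>

lemma bernoulli_poly_one_eq_0:
  assumes "even k" "k > 0"
  shows "bernoulli_poly (Suc k) 1 = 0"
  using bernoulli_poly_add_one [of k 0] bernoulli_poly_reflect [of "Suc k" 0] assms by (simp add: zero_power)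

text \<open>Here \<open>a\<close> is \<open>f + 1 - N / e\<close>. An integer \<open>z\<close> close
  to \<open>a\<close> in the n-adic sense is reached from \<open>f + 1\<close> by adding a multiple
  of \<open>N\<close>; the extra summands fill complete residue systems modulo \<open>N\<close> and
  vanish there.\<close>

lemma partial_power_sum_cong:
  fixes a :: rat
  assumes "n > 0" "coprime e n" "e > 0" "even k" "k > 0"
    and N: "N dvd (\<Sum>s<N. s ^ k)"
    and a: "of_nat (e * (f + 1)) = of_nat N + of_nat e * a"
  shows "\<exists>q\<in>local_ints n.
    of_nat (\<Sum>s = 1..f. s ^ k) - bernoulli_poly (Suc k) a / of_nat (Suc k) = of_nat N * q"
proof -
  define P where "P x = bernoulli_poly (Suc k) x / of_nat (Suc k)" for x
  obtain c where c: "\<And>x. bernoulli_poly (Suc k) x = (\<Sum>i\<le>Suc k. c i * x ^ i)"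
    using bernoulli_poly_polynomial by metis
  have P: "P x = (\<Sum>i<Suc (Suc k). c i / of_nat (Suc k) * x ^ i)" for x
    unfolding P_def c by (simp only: lessThan_Suc_atMost sum_divide_distrib) simp
  obtain L where L: "\<And>x y. x \<in> local_ints n \<Longrightarrow> y \<in> local_ints n \<Longrightarrow>
      \<exists>q\<in>local_ints n. of_nat n ^ L * (P x - P y) = (x - y) * q"
    using polynomial_lipschitz_local_ints [OF assms(1), where c = "\<lambda>i. c i / of_nat (Suc k)"]
    unfolding P by blast
  have inv_e: "1 / of_nat e \<in> local_ints n"
    using assms by (intro local_ints_inverse_of_nat)
  have a_in: "a \<in> local_ints n"
  proof -
    have "a = (of_nat (e * (f + 1)) - of_nat N) * (1 / of_nat e)"
      using a \<open>e > 0\<close> by (simp add: field_simps)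
    then show ?thesis using inv_e by (metis local_ints_diff local_ints_mult of_nat_in_local_ints)
  qed
  \<comment> \<open>The aim is a natural number \<open>t\<close> that acts as \<open>- 1 / e\<close>
    modulo \<open>n ^ L\<close>; the factor \<open>n ^ L - 1\<close> stands for -1.\<close>
  obtain x where "[e * x = 1] (mod n ^ L)"
    using cong_solve_coprime_nat [of e "n ^ L"] assms by auto
  then have "[e * (x * (n ^ L - 1)) + 1 = 1 * (n ^ L - 1) + 1] (mod n ^ L)"
    unfolding mult.assoc [symmetric] by (intro cong_add cong_mult) auto
  then have "n ^ L dvd e * (x * (n ^ L - 1)) + 1"
    using assms(1) by (simp add: cong_def mod_eq_0_iff_dvd [symmetric])
  then obtain t v where tv: "e * t + 1 = n ^ L * v" by blast
  \<comment> \<open>Then \<open>z - a = N * (e * t + 1) / e\<close>. Its factor \<open>n ^ L\<close>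
    pays for the loss in the Lipschitz bound, and the factor \<open>N\<close> survives as the
    modulus.\<close>
  define z where "z = f + 1 + N * t"
  have z: "of_nat z - a = of_nat N * of_nat n ^ L * of_nat v * (1 / of_nat e)"
  proof -
    have "of_nat e * of_nat t + 1 = (of_nat n ^ L * of_nat v :: rat)"
      using arg_cong [OF tv, of "of_nat :: nat \<Rightarrow> rat"] by simp
    moreover have "of_nat e * (of_nat z - a) = of_nat N * (of_nat e * of_nat t + 1)"
      using a unfolding z_def by (simp add: algebra_simps)
    ultimately show ?thesis using \<open>e > 0\<close> by (simp add: field_simps)
  qed
  obtain q where q: "q \<in> local_ints n" "of_nat n ^ L * (P (of_nat z) - P a) = (of_nat z - a) * q"
    using L [OF of_nat_in_local_ints a_in] by blast
  have "of_nat n ^ L * (P (of_nat z) - P a) =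
      of_nat n ^ L * (of_nat N * (of_nat v * (1 / of_nat e) * q))"
    unfolding q(2) z by (simp only: mult_ac)
  moreover have "of_nat n ^ L \<noteq> (0 :: rat)" using assms(1) by simp
  ultimately have Pz: "P (of_nat z) - P a = of_nat N * (of_nat v * (1 / of_nat e) * q)"
    by (metis mult_left_cancel)
  obtain w where w: "(\<Sum>s = f + 1..<f + 1 + N * t. s ^ k) = N * w"
    using dvd_sum_power_block [OF N] by blast
  have "of_nat (\<Sum>s = 1..<z. s ^ k) = P (of_nat z) - P (of_nat 1)"
    unfolding P_def by (subst sum_power_bernoulli) (auto simp: z_def diff_divide_distrib)
  moreover have "P (of_nat 1) = 0"
    using bernoulli_poly_one_eq_0 assms by (simp add: P_def)
  moreover have "(\<Sum>s = 1..<z. s ^ k) = (\<Sum>s = 1..f. s ^ k) + N * w"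
    unfolding w [symmetric] z_def
    by (subst sum.atLeastLessThan_concat [symmetric, of 1 "f + 1"])
       (auto simp: atLeastLessThanSuc_atLeastAtMost)
  ultimately have "of_nat (\<Sum>s = 1..f. s ^ k) - P a = P (of_nat z) - P a - of_nat N * of_nat w"
    by (simp del: of_nat_sum)
  also have "\<dots> = of_nat N * (of_nat v * (1 / of_nat e) * q - of_nat w)"
    unfolding Pz by (simp add: algebra_simps)
  finally have "of_nat (\<Sum>s = 1..f. s ^ k) - P a =
      of_nat N * (of_nat v * (1 / of_nat e) * q - of_nat w)" .
  moreover have "of_nat v * (1 / of_nat e) * q - of_nat w \<in> local_ints n"
    by (intro local_ints_diff local_ints_mult of_nat_in_local_ints inv_e q(1))
  ultimately show ?thesis unfolding P_def by blast
qed

section \<open>Moebius inversion\<close>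

lemma moebius_mu_mult_prime:
  assumes "prime p" "\<not> p dvd d" "squarefree d"
  shows "moebius_mu (p * d) = - moebius_mu d"
proof -
  have "d \<noteq> 0" using assms(2) by (intro notI) simp
  have "coprime p d" using assms by (simp add: prime_imp_coprime)
  then have "squarefree (p * d)"
    using assms by (simp add: squarefree_mult_coprime squarefree_prime)
  moreover have "prime_factors (p * d) = insert p (prime_factors d)"
    using assms \<open>d \<noteq> 0\<close> by (subst prime_factors_product) (auto simp: prime_prime_factors)
  moreover have "p \<notin> prime_factors d" using assms by auto
  ultimately show ?thesis using assms(3) by (simp add: moebius_mu_def)
qed

text \<open>For a prime \<open>p\<close> dividing \<open>m\<close>, the squarefree divisors pair up
  as \<open>d\<close> and \<open>p * d\<close> with \<open>p\<close> not dividing \<open>d\<close>,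
  and the two values of \<open>moebius_mu\<close> cancel.\<close>

lemma sum_moebius_mu_dvd:
  assumes "m > 0"
  shows "(\<Sum>d | d dvd m. moebius_mu d) = (if m = 1 then 1 else 0)"
proof (cases "m = 1")
  case True
  then show ?thesis by (simp add: moebius_mu_def)
next
  case False
  then obtain p where p: "prime p" "p dvd m" using prime_factor_nat by blast
  define A where "A = {d. d dvd m \<and> squarefree d \<and> \<not> p dvd d}"
  have fin: "finite {d. d dvd m}" using assms by simp
  have finA: "finite A" by (rule finite_subset [OF _ fin]) (auto simp: A_def)
  have p0: "p > 0" using p(1) prime_gt_0_nat by blast
  have "(\<Sum>d | d dvd m. moebius_mu d) = (\<Sum>d | d dvd m \<and> squarefree d. moebius_mu d)"
    using fin by (intro sum.mono_neutral_right) (auto simp: moebius_mu_def)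
  also have "{d. d dvd m \<and> squarefree d} = A \<union> (*) p ` A"
  proof (intro equalityI subsetI)
    fix d assume d: "d \<in> {d. d dvd m \<and> squarefree d}"
    show "d \<in> A \<union> (*) p ` A"
    proof (cases "p dvd d")
      case True
      then obtain c where c: "d = p * c" by blast
      have "\<not> p dvd c"
      proof
        assume "p dvd c"
        then have "p ^ 2 dvd d" unfolding c by (auto simp: power2_eq_square)
        then show False using d p(1) squarefreeD [of d p] by auto
      qed
      moreover have "squarefree c" using d c squarefree_mono [of c d] by simp
      moreover have "c dvd m" using d c by (auto dest: dvd_mult_right)
      ultimately show ?thesis using c by (auto simp: A_def)
    qed (use d in \<open>auto simp: A_def\<close>)
  next
    fix d assume "d \<in> A \<union> (*) p ` A"
    then show "d \<in> {d. d dvd m \<and> squarefree d}"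
      using p by (auto simp: A_def squarefree_mult_coprime squarefree_prime prime_imp_coprime
          intro: divides_mult)
  qed
  also have "(\<Sum>d\<in>A \<union> (*) p ` A. moebius_mu d) =
      (\<Sum>d\<in>A. moebius_mu d) + (\<Sum>d\<in>(*) p ` A. moebius_mu d)"
    using finA by (intro sum.union_disjoint) (auto simp: A_def)
  also have "(\<Sum>d\<in>(*) p ` A. moebius_mu d) = (\<Sum>d\<in>A. moebius_mu (p * d))"
    using p0 by (subst sum.reindex) (auto simp: inj_on_def)
  also have "\<dots> = (\<Sum>d\<in>A. - moebius_mu d)"
    by (intro sum.cong) (auto simp: A_def moebius_mu_mult_prime p)
  finally show ?thesis using False by (simp add: sum_negf)
qed

text \<open>The indicator of \<open>coprime r n\<close> is the sum of \<open>moebius_mu\<close> over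
  the common divisors of \<open>r\<close> and \<open>n\<close>. After exchanging the sums,
  \<open>r\<close> runs over the multiples \<open>d * s\<close> up to \<open>K\<close>.\<close>

lemma sum_coprime_moebius:
  fixes g :: "nat \<Rightarrow> 'a::comm_ring_1"
  assumes "n > 0"
  shows "(\<Sum>r | 1 \<le> r \<and> r \<le> K \<and> coprime r n. g r) =
    (\<Sum>d | d dvd n. of_int (moebius_mu d) * (\<Sum>s = 1..K div d. g (d * s)))"
proof -
  have fin: "finite {d. d dvd n}" using assms by simp
  have mu: "(\<Sum>d | d dvd n \<and> d dvd r. of_int (moebius_mu d)) = (if coprime r n then 1 else 0 :: 'a)"
    for r
  proof -
    have "{d. d dvd n \<and> d dvd r} = {d. d dvd gcd r n}" by auto
    then have "(\<Sum>d | d dvd n \<and> d dvd r. of_int (moebius_mu d)) =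
        (of_int (\<Sum>d | d dvd gcd r n. moebius_mu d) :: 'a)"
      by (simp only: of_int_sum)
    also have "(\<Sum>d | d dvd gcd r n. moebius_mu d) = (if gcd r n = 1 then 1 else 0)"
      using assms by (intro sum_moebius_mu_dvd) simp
    finally show ?thesis by (simp only: coprime_iff_gcd_eq_1 if_distrib of_int_0 of_int_1)
  qed
  have inner: "(\<Sum>r | r \<in> {1..K} \<and> d dvd r. g r) = (\<Sum>s = 1..K div d. g (d * s))"
    if "d dvd n" for d
  proof -
    have "d > 0" using that assms by (auto intro: Nat.gr0I)
    then have "{r. r \<in> {1..K} \<and> d dvd r} = (*) d ` {1..K div d}"
      by (auto simp: less_eq_div_iff_mult_less_eq mult.commute elim!: dvdE)
    moreover have "inj_on ((*) d) {1..K div d}" using \<open>d > 0\<close> by (simp add: inj_on_def)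
    ultimately show ?thesis by (simp add: sum.reindex)
  qed
  have "(\<Sum>r | 1 \<le> r \<and> r \<le> K \<and> coprime r n. g r) =
      (\<Sum>r = 1..K. (if coprime r n then 1 else 0) * g r)"
    by (rule sum.mono_neutral_cong_left) auto
  also have "\<dots> = (\<Sum>r = 1..K. \<Sum>d | d dvd n \<and> d dvd r. of_int (moebius_mu d) * g r)"
    by (simp only: mu [symmetric] sum_distrib_right)
  also have "\<dots> = (\<Sum>d | d dvd n. \<Sum>r | r \<in> {1..K} \<and> d dvd r. of_int (moebius_mu d) * g r)"
    using sum.swap_restrict [of "{1..K}" "{d. d dvd n}" "\<lambda>r d. of_int (moebius_mu d) * g r"
      "\<lambda>r d. d dvd r"] fin by simp
  also have "\<dots> = (\<Sum>d | d dvd n. of_int (moebius_mu d) * (\<Sum>s = 1..K div d. g (d * s)))"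
    by (intro sum.cong refl) (simp only: sum_distrib_left [symmetric] inner mem_Collect_eq)
  finally show ?thesis .
qed

section \<open>The sign J\<close>

text \<open>Modulo 2, 3, 4 or 6 the only units are 1 and -1.\<close>

lemma coprime_6_cases:
  fixes m e :: nat
  assumes "coprime m 6" "e \<in> {2, 3, 4, 6}"
  shows "m mod e = 1 \<or> m mod e = e - 1"
proof -
  have "\<not> 2 dvd m" "\<not> 3 dvd m"
    using assms(1) coprime_common_divisor [of m 6 2] coprime_common_divisor [of m 6 3] by auto
  then show ?thesis using assms(2) by auto presburger+
qed

lemma J_cases:
  assumes "coprime m 6" "e \<in> {2, 3, 4, 6}"
  obtains "J e (int m) = 1" "m mod e = 1" | "J e (int m) = - 1" "m mod e = e - 1" "e \<noteq> 2"
proof -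
  have e: "e > 1" using assms(2) by auto
  have one: "[int m = 1] (mod int e) \<longleftrightarrow> m mod e = 1"
    using e cong_int_iff [of m 1 e] by (simp add: cong_def)
  consider "m mod e = 1" | "m mod e = e - 1" "m mod e \<noteq> 1"
    using coprime_6_cases [OF assms] by blast
  then show ?thesis
  proof cases
    case 1
    then show ?thesis using one that(1) by (simp add: J_def)
  next
    case 2
    then have "Suc m mod e = 0" using e by (simp add: mod_Suc)
    then have "int e dvd int (Suc m)" by (simp add: mod_eq_0_iff_dvd del: of_nat_Suc)
    then have "[int m = - 1] (mod int e)" by (simp add: cong_iff_dvd_diff add.commute)
    then show ?thesis using 2 one by (intro that(2)) (auto simp: J_def)
  qed
qed

lemma cong_J: "J e m \<noteq> 0 \<Longrightarrow> [m = J e m] (mod int e)"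
  by (auto simp: J_def split: if_splits)

text \<open>Both sides are signs congruent modulo \<open>e\<close>. For \<open>e > 2\<close> this
  forces equality, and for \<open>e = 2\<close> every sign is 1.\<close>

lemma J_mult:
  assumes "coprime a 6" "coprime b 6" "e \<in> {2, 3, 4, 6}"
  shows "J e (int (a * b)) = J e (int a) * J e (int b)"
proof -
  have sign: "J e (int m) = 1 \<or> J e (int m) = - 1 \<and> e \<noteq> 2" if "coprime m 6" for m
    by (rule J_cases [OF that assms(3)]) simp_all
  have "coprime (a * b) 6" using assms by simp
  note signs = sign [OF this] sign [OF assms(1)] sign [OF assms(2)]
  have "[J e (int (a * b)) = int (a * b)] (mod int e)"
    using signs by (intro cong_sym [OF cong_J]) auto
  also have "[int (a * b) = J e (int a) * J e (int b)] (mod int e)"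
    unfolding of_nat_mult using signs by (intro cong_mult cong_J) auto
  finally have "[J e (int (a * b)) = J e (int a) * J e (int b)] (mod int e)" .
  moreover have "\<not> [1 = - 1] (mod int e)" "\<not> [- 1 = 1] (mod int e)" if "e \<noteq> 2"
    using that assms(3) by (auto simp: cong_def)
  ultimately show ?thesis
    using signs by (cases "e = 2") auto
qed

text \<open>The sign arises from rounding: \<open>N div e + 1 - N / e\<close> is
  \<open>1 - 1 / e\<close> or \<open>1 / e\<close> according to the residue of \<open>N\<close>, and
  reflection in the odd degree \<open>Suc k\<close> relates the two values by a factor -1.\<close>

lemma partial_power_sum_cong_J:
  fixes n e :: nat
  assumes "n > 0" "coprime n 6" "e \<in> {2, 3, 4, 6}" "N dvd n" "even k" "k > 0"
    "[4 * 2 ^ k = 1] (mod n)"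
  shows "\<exists>q\<in>local_ints n. of_nat (\<Sum>s = 1..N div e. s ^ k) +
    of_int (J e (int N)) * bernoulli_poly (Suc k) (1 / of_nat e) / of_nat (Suc k) = of_nat N * q"
proof -
  have e: "e > 0" "coprime e n"
  proof -
    show "e > 0" using assms(3) by auto
    \<comment> \<open>The square of 6 is taken because \<open>e = 4\<close> does not divide
      6.\<close>
    have "e dvd 6 * 6" using assms(3) by auto
    moreover have "coprime (6 * 6) n" 
      using assms(2) by (simp only: coprime_mult_left_iff coprime_commute [of 6 n] simp_thms)
    ultimately show "coprime e n" by (meson coprime_divisors dvd_refl)
  qed
  have N6: "coprime N 6" using assms(2,4) by (meson coprime_divisors dvd_refl)
  have sum: "N dvd (\<Sum>s<N. s ^ k)"
    using N6 by (rule dvd_sum_power_lessThan) (rule cong_dvd_modulus_nat [OF assms(7,4)])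
  define \<sigma> where "\<sigma> = J e (int N)"
  have \<sigma>: "\<sigma> = 1 \<and> N mod e = 1 \<or> \<sigma> = - 1 \<and> N mod e = e - 1"
    by (rule J_cases [OF N6 assms(3)]) (simp_all add: \<sigma>_def)
  define a :: rat where "a = (if \<sigma> = 1 then 1 - 1 / of_nat e else 1 / of_nat e)"
  have "bernoulli_poly (Suc k) a = - of_int \<sigma> * bernoulli_poly (Suc k) (1 / of_nat e)"
    using \<sigma> assms(5) by (auto simp: a_def bernoulli_poly_reflect)
  moreover have "of_nat (e * (N div e + 1)) = of_nat N + of_nat e * a"
  proof -
    have "of_nat N = (of_nat e * of_nat (N div e) + of_nat (N mod e) :: rat)"
      by (metis mult_div_mod_eq of_nat_add of_nat_mult)
    moreover have "of_nat (N mod e) + of_nat e * a = of_nat e"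
      using \<sigma> e(1) by (auto simp: a_def field_simps of_nat_diff)
    ultimately show ?thesis by (simp add: algebra_simps)
  qed
  ultimately show ?thesis
    using partial_power_sum_cong [OF assms(1) e(2,1) assms(5,6) sum]
    unfolding \<sigma>_def by fastforce
qed

section \<open>The congruence\<close>

text \<open>Euler's theorem, divided by the square of the unit \<open>r\<close>.\<close>

lemma inverse_square_cong_power:
  assumes "n > 1" "coprime r n" "r > 0" "totient n \<ge> 2"
  shows "\<exists>q\<in>local_ints n. 1 / (of_nat r)\<^sup>2 - of_nat (r ^ (totient n - 2)) = of_nat n * q"
proof -
  have "[int (r ^ totient n) = 1] (mod int n)"
    using euler_theorem [OF assms(2)] by (metis cong_int_iff of_nat_1)
  then have "int n dvd int (r ^ totient n) - 1" by (simp only: cong_iff_dvd_diff)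
  then obtain u where "int (r ^ totient n) - 1 = int n * u" by blast
  then have u: "of_nat r ^ totient n - 1 = (of_nat n * of_int u :: rat)"
    by (metis of_int_diff of_int_mult of_int_of_nat_eq of_nat_power of_int_1)
  have "of_nat r ^ totient n = (of_nat r ^ (totient n - 2) * (of_nat r)\<^sup>2 :: rat)"
    using assms(4) by (metis power_add le_add_diff_inverse2)
  then have "1 / (of_nat r)\<^sup>2 - of_nat (r ^ (totient n - 2)) =
      (- (of_nat r ^ totient n - 1) / (of_nat r)\<^sup>2 :: rat)"
    using assms(3) by (simp add: field_simps)
  also have "\<dots> = of_nat n * (of_int (- u) * (1 / of_nat r * (1 / of_nat r)))"
    unfolding u by (simp add: power2_eq_square)
  finally have "1 / (of_nat r)\<^sup>2 - of_nat (r ^ (totient n - 2)) =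
      of_nat n * (of_int (- u) * (1 / of_nat r * (1 / of_nat r)) :: rat)" .
  moreover have "of_int (- u) * (1 / of_nat r * (1 / of_nat r)) \<in> local_ints n"
    by (intro local_ints_mult of_int_in_local_ints local_ints_inverse_of_nat assms(2,3))
  ultimately show ?thesis by blast
qed

text \<open>The exponent \<open>2 - int t\<close> is not positive, so the summand contains
  \<open>(d / n) ^ (t - 2)\<close>, and the factor in front cancels the power of
  \<open>n\<close>.\<close>

lemma gen_totient_eq:
  assumes "n > 0" "t \<ge> 2"
  shows "of_nat n ^ (t - 2) * gen_totient (2 - int t) f n =
    (\<Sum>d | d dvd n. of_nat d ^ (t - 2) * of_int (f d) * of_int (moebius_mu d))"
  unfolding gen_totient_def sum_distrib_left
proof (rule sum.cong [OF refl])
  fix d assume "d \<in> {d. d dvd n}"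
  then have "d > 0" using assms(1) by (auto intro: Nat.gr0I)
  have "(of_nat n / of_nat d) powi (- int m) = (of_nat d / of_nat n :: rat) ^ m" for m
    by (simp add: power_int_minus flip: power_inverse)
  moreover have "2 - int t = - int (t - 2)" using assms(2) by simp
  ultimately have "(of_nat n / of_nat d) powi (2 - int t) = (of_nat d / of_nat n :: rat) ^ (t - 2)"
    by metis
  then show "of_nat n ^ (t - 2) * ((of_nat n / of_nat d) powi (2 - int t) * of_int (f d) *
      of_int (moebius_mu d)) = of_nat d ^ (t - 2) * of_int (f d) * rat_of_int (moebius_mu d)"
    using assms(1) by (simp add: power_divide)
qed

text \<open>This makes the exponent \<open>totient n - 2\<close> even and positive. Since
  \<open>n\<close> is at least 5 and prime to 6, the numbers 1 to 4 are totatives.\<close>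

lemma totient_even_ge_4:
  assumes "n > 1" "coprime n 6"
  shows "even (totient n)" "totient n \<ge> 4"
proof -
  have "\<not> 2 dvd n" "\<not> 3 dvd n"
    using assms(2) coprime_common_divisor [of n 6 2] coprime_common_divisor [of n 6 3] by auto
  then have n: "n > 4" using assms(1) by presburger
  then show "even (totient n)" by (intro totient_even) simp
  have "coprime 2 n" "coprime 3 n"
    unfolding coprime_commute [of _ n] by (rule coprime_divisors [OF dvd_refl _ assms(2)], simp)+
  moreover from this(1) have "coprime 4 n"
    using coprime_power_left_iff [of 2 2 n] by simp
  ultimately have "{1, 2, 3, 4} \<subseteq> totatives n"
    using n by (auto simp: in_totatives_iff)
  then have "card {1, 2, 3, 4 :: nat} \<le> totient n"
    unfolding totient_def by (intro card_mono) auto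
  then show "totient n \<ge> 4" by simp
qed

theorem theorem1:
  fixes n e :: nat
  assumes "n > 1" and "coprime n 6" and "e \<in> {2, 3, 4, 6}"
  shows "rat_cong
    (\<Sum>r | 1 \<le> r \<and> r \<le> n div e \<and> coprime r n. 1 / (of_nat r :: rat)\<^sup>2)
    (- of_int (J e (int n)) * of_nat n ^ (totient n - 2)
       * gen_totient (2 - int (totient n)) (\<lambda>d. J e (int d)) n
       * (bernoulli_poly (totient n - 1) (1 / of_nat e) / of_nat (totient n - 1)))
    n"
proof -
  note t = totient_even_ge_4 [OF assms(1,2)]
  define k where "k = totient n - 2"
  have k: "even k" "k > 0" "totient n - 1 = Suc k" "totient n = k + 2"
    using t by (auto simp: k_def)
  have k2: "[4 * 2 ^ k = 1] (mod n)"
  proof -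
    have "coprime 2 n" using coprime_divisors [OF _ dvd_refl, of 2 6 n] assms(2) by (simp add: coprime_commute)
    then have "[2 ^ totient n = 1] (mod n)" by (rule euler_theorem)
    then show ?thesis by (simp add: k(4) power_add mult.commute)
  qed
  define P where "P = bernoulli_poly (Suc k) (1 / of_nat e) / of_nat (Suc k)"
  define A where "A = {r. 1 \<le> r \<and> r \<le> n div e \<and> coprime r n}"
  define D where "D = {d. d dvd n}"
  have "\<exists>q\<in>local_ints n. 1 / (of_nat r)\<^sup>2 - of_nat (r ^ k) = of_nat n * q" if "r \<in> A" for r
    using inverse_square_cong_power [of n r] that assms(1) t(2) unfolding A_def k_def by simp
  then obtain u where u: "\<And>r. r \<in> A \<Longrightarrow> u r \<in> local_ints n"
    "\<And>r. r \<in> A \<Longrightarrow> 1 / (of_nat r)\<^sup>2 - of_nat (r ^ k) = of_nat n * u r"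
    by metis
  have "\<exists>q\<in>local_ints n. of_nat (\<Sum>s = 1..n div d div e. s ^ k) +
    of_int (J e (int (n div d))) * P = of_nat (n div d) * q" if "d \<in> D" for d
    using partial_power_sum_cong_J [of n e "n div d" k] assms k k2 that
    unfolding P_def D_def by (auto simp: div_dvd_iff_mult)
  then obtain w where w: "\<And>d. d \<in> D \<Longrightarrow> w d \<in> local_ints n"
    "\<And>d. d \<in> D \<Longrightarrow> of_nat (\<Sum>s = 1..n div d div e. s ^ k) +
    of_int (J e (int (n div d))) * P = of_nat (n div d) * w d"
    by metis
  \<comment> \<open>The contribution of \<open>d\<close> comes from the congruence modulo
    \<open>n div d\<close>, multiplied by \<open>d ^ k\<close>; one factor \<open>d\<close> raises
    the modulus to \<open>n\<close>.\<close>
  have summand: "of_int (moebius_mu d) * (\<Sum>s = 1..n div e div d. of_nat ((d * s) ^ k)) +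
      of_int (J e (int n)) * (of_nat d ^ k * of_int (J e (int d)) * of_int (moebius_mu d)) * P =
      of_nat n * (of_int (moebius_mu d) * of_nat d ^ (k - 1) * w d)" if "d \<in> D" for d
  proof -
    have nd: "n = d * (n div d)" using that by (simp add: D_def)
    have cop: "coprime d 6" "coprime (n div d) 6"
      using assms(2) nd by (metis coprime_mult_left_iff)+
    \<comment> \<open>A sign is its own inverse, so multiplying \<open>J\<close> at \<open>n\<close>
      by \<open>J\<close> at \<open>d\<close> gives \<open>J\<close> at the cofactor
      \<open>n div d\<close>.\<close>
    have "J e (int d) * J e (int d) = 1"
      using J_cases [OF cop(1) assms(3)] by (metis minus_mult_minus mult_1)
    then have "J e (int n) * J e (int d) = J e (int (n div d))"
      using J_mult [OF cop assms(3)] nd by (metis mult.commute mult.left_commute mult_1)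
    then have J: "of_int (J e (int n)) * of_int (J e (int d)) = (of_int (J e (int (n div d))) :: rat)"
      by (metis of_int_mult)
    \<comment> \<open>Both iterated quotients equal \<open>n div (e * d)\<close>, so the summation
      bounds agree.\<close>
    have "(\<Sum>s = 1..n div e div d. of_nat ((d * s) ^ k)) =
        (of_nat d ^ k * of_nat (\<Sum>s = 1..n div d div e. s ^ k) :: rat)"
      by (simp add: div_mult2_eq [symmetric] mult.commute [of d e] power_mult_distrib sum_distrib_left)
    then have "of_int (moebius_mu d) * (\<Sum>s = 1..n div e div d. of_nat ((d * s) ^ k)) +
      of_int (J e (int n)) * (of_nat d ^ k * of_int (J e (int d)) * of_int (moebius_mu d)) * P =
      of_int (moebius_mu d) * of_nat d ^ k *
        (of_nat (\<Sum>s = 1..n div d div e. s ^ k) + of_int (J e (int (n div d))) * P)"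
      unfolding J [symmetric] by (simp only:) (simp add: algebra_simps)
    also have "\<dots> = of_int (moebius_mu d) * (of_nat d * of_nat d ^ (k - 1)) * (of_nat (n div d) * w d)"
      using k(2) w(2) [OF that] by (simp add: power_eq_if)
    also have "\<dots> = of_nat (d * (n div d)) * (of_int (moebius_mu d) * of_nat d ^ (k - 1) * w d)"
      by simp
    finally show ?thesis using nd by simp
  qed
  define RHS where "RHS = - of_int (J e (int n)) * of_nat n ^ k
       * gen_totient (2 - int (totient n)) (\<lambda>d. J e (int d)) n * P"
  have RHS: "- RHS = (\<Sum>d\<in>D. of_int (J e (int n)) *
      (of_nat d ^ k * of_int (J e (int d)) * of_int (moebius_mu d)) * P)"
  proof -
    have "- RHS = of_int (J e (int n)) *
      (of_nat n ^ k * gen_totient (2 - int (totient n)) (\<lambda>d. J e (int d)) n) * P"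
      by (simp add: RHS_def)
    then show ?thesis
      using gen_totient_eq [of n "totient n" "\<lambda>d. J e (int d)"] assms(1) t(2)
      by (simp add: k_def [symmetric] D_def [symmetric] sum_distrib_left sum_distrib_right)
  qed
  \<comment> \<open>The first sum is the error of replacing inverse squares by \<open>k\<close>-th
    powers; the rest is treated divisor by divisor through \<open>summand\<close>.\<close>
  have "(\<Sum>r\<in>A. 1 / (of_nat r :: rat)\<^sup>2) - RHS =
      (\<Sum>r\<in>A. 1 / (of_nat r)\<^sup>2 - of_nat (r ^ k)) + ((\<Sum>r\<in>A. of_nat (r ^ k)) + (- RHS))"
    by (simp add: sum_subtractf)
  also have "(\<Sum>r\<in>A. of_nat (r ^ k)) =
      (\<Sum>d\<in>D. of_int (moebius_mu d) * (\<Sum>s = 1..n div e div d. rat_of_nat ((d * s) ^ k)))"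
    unfolding A_def D_def using assms(1) by (intro sum_coprime_moebius) simp
  also have "\<dots> + (- RHS) = (\<Sum>d\<in>D. of_nat n * (of_int (moebius_mu d) * of_nat d ^ (k - 1) * w d))"
    unfolding RHS sum.distrib [symmetric] by (intro sum.cong refl summand)
  also have "(\<Sum>r\<in>A. 1 / (of_nat r :: rat)\<^sup>2 - of_nat (r ^ k)) = (\<Sum>r\<in>A. of_nat n * u r)"
    using u(2) by (intro sum.cong refl)
  finally have "(\<Sum>r\<in>A. 1 / (of_nat r :: rat)\<^sup>2) - RHS =
      of_nat n * ((\<Sum>r\<in>A. u r) + (\<Sum>d\<in>D. of_int (moebius_mu d) * of_nat d ^ (k - 1) * w d))"
    by (simp add: sum_distrib_left distrib_left)
  then have "rat_cong (\<Sum>r\<in>A. 1 / (of_nat r :: rat)\<^sup>2) RHS n"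
    by (rule rat_congI) (intro local_ints_add local_ints_sum local_ints_mult local_ints_power
        of_int_in_local_ints of_nat_in_local_ints u(1) w(1); assumption)
  then show ?thesis
    unfolding A_def RHS_def P_def k_def using k(3) by (simp add: k_def)
qed

end
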